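(* Consider the restless bandit problem with switching costs (RBPSC) with $N$ sites and $M\le N$ active agents, as defined in the context, and let $V^*$ be its optimal expected infinite-horizon discounted reward. Let $b_i=1$ if $i\le M$ and $b_i=0$ if $i>M$. Consider the following linear program in the real variables $u^i_{s,a}(x)$, for $(i,s,a)\in[N]^3$, $x\in S_s$, and $v^i_{s,a}(x)$, for $(i,s,a)\in[N]^3$, $x\in S_a$, where when $s=a$ the two families are the same variables: $u^i_{s,s}(x)=v^i_{s,s}(x)$ for all $i,s\in[N]$, $x\in S_s$. Maximize $$\sum_{s=1}^N\sum_{a=1}^N\sum_{x\in S_a}\Big[\big(r^1_a(x)-c_{sa}\big)\sum_{i=1}^M v^i_{s,a}(x)+r^0_a(x)\sum_{i=M+1}^N v^i_{s,a}(x)\Big]$$ subject to (1) $\displaystyle \sum_{a=1}^N u^i_{s,a}(x)-\alpha\sum_{\tilde x\in S_s}\sum_{s'=1}^N v^i_{s',s}(\tilde x)\,p^{b_i}_s(\tilde x,x)=(1-\alpha)\,\nu_s(x)\,\delta_{d_i}(s)$ for all $(i,s)\in[N]^2$, $x\in S_s$; (2) $\displaystyle \sum_{x\in S_s}u^i_{s,a}(x)=\sum_{x\in S_a}v^i_{s,a}(x)$ for all $(i,s,a)\in[N]^3$; (3) $\displaystyle \sum_{i=1}^N\sum_{a=1}^N u^i_{j,a}(x)=\sum_{i=1}^N\sum_{s=1}^N v^i_{s,j}(x)$ for all $j\in[N]$, $x\in S_j$; (4) $\displaystyle \sum_{s=1}^N\sum_{x\in S_s}\sum_{a\in[N]\setminus\{\tilde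 a\}}u^i_{s,a}(x)=\sum_{k\in[N]\setminus\{i\}}\sum_{s=1}^N\sum_{x\in S_s}u^k_{s,\tilde a}(x)$ for all $(i,\tilde a)\in[N]^2$; (5) $\displaystyle \sum_{a=1}^N\sum_{x\in S_a}\sum_{s\in[N]\setminus\{\tilde s\}}v^i_{s,a}(x)=\sum_{k\in[N]\setminus\{i\}}\sum_{a=1}^N\sum_{x\in S_a}v^k_{\tilde s,a}(x)$ for all $(i,\tilde s)\in[N]^2$; (6) $u^i_{s,a}(x)\ge 0$ for all $(i,s,a)\in[N]^3$, $x\in S_s$, and $v^i_{s,a}(x)\ge0$ for all $(i,s,a)\in[N]^3$, $x\in S_a$. Then the optimal value $Z_r$ of this linear program is an upper bound on the optimal reward achievable in the RBPSC, in the normalization $(1-\alpha)V^*\le Z_r$.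
   Context: Notation: $[N]=\{1,\dots,N\}$; $\delta_y(z)=1$ if $y=z$ and $0$ otherwise; $\Pi_{[N]}$ is the set of permutation vectors $\mathbf s=(s_1,\dots,s_N)$ of $[N]$. The RBPSC. There are $N$ sites; site $n$ has a finite state space $S_n$, and $\mathcal S=S_1\times\cdots\times S_N$. There are $N$ agents; agents $1,\dots,M$ are active (real servers) and agents $M+1,\dots,N$ are passive (fictitious). At every time each site is occupied by exactly one agent. A system state is $(\mathbf x;\mathbf s)\in\mathcal S\times\Pi_{[N]}$, where $x_n$ is the state of site $n$ and $s_i$ is the site of agent $i$. An action is $\mathbf a\in\Pi_{[N]}$, where $a_i$ is the site to which agent $i$ is sent. For each site $n$, $p^1_n$ (active) and $p^0_n$ (passive) are transition probability matrices on $S_n$, and $r^1_n,r^0_n:S_n\to\mathbb R$ are the active and passive rewards. The $c_{kl}\in\mathbb R$, $k,l\in[N]$, are arbitrary switching costs ($c_{kk}$ may be nonzero). Taking action $\mathbf a$ in state $(\mathbf x;\mathbf s)$ gives immediate reward $$R((\mathbf x;\mathbf s),\mathbf a)=\sum_{i=1}^M\big(r^1_{a_i}(x_{a_i})-c_{s_ia_i}\big)+\sum_{i=M+1}^N r^0_{a_i}(x_{a_i}),$$ and the next state is $(\mathbf x';\mathbf a)$ with probability $$\mathcal P_{\mathbf x\,\mathbf a\,\mathbf x'}=\prod_{i=1}^M p^1_{a_i}(x_{a_i},x'_{a_i})\prod_{i=M+1}^N p^0_{a_i}(x_{a_i},x'_{a_i}).$$ The initial state has the product distribution $\nu(\mathbf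 x;\mathbf s)=\prod_{i=1}^N\nu_i(x_i)\,\delta_{d_i}(s_i)$, where $\nu_i$ is a probability distribution on $S_i$ and $\mathbf d\in\Pi_{[N]}$ is fixed. The discount factor is $\alpha\in(0,1)$. $V^*$ is the supremum, over all (history-dependent, possibly randomized) policies, of $\mathbb E\big[\sum_{t\ge1}\alpha^{t-1}R((\mathbf x(t);\mathbf s(t)),\mathbf a(t))\big]$ with initial distribution $\nu$ at time $t=1$. Interpretation of the variables: $u^i_{s,a}(x)$ (resp. $v^i_{s,a}(x)$) represents the normalized discounted frequency with which agent $i$ moves from site $s$ to site $a$ while the origin site $s$ (resp. the destination site $a$) is in state $x$. *)

theory Defs
  imports "HOL-Probability.Probability"
begin

text \<open>
  Sites and agents are the numbers \<open>1, \<dots>, N\<close>; agent \<open>i\<close> is active iff \<open>i \<le> M\<close>. The index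
  \<open>b\<close> of \<open>trans_prob\<close> and \<open>reward\<close> is \<open>1\<close> (active) or \<open>0\<close> (passive). All state spaces are finite
  subsets of one type, and a joint site state is an element of \<open>PiE {1..N} S\<close>. A permutation
  vector is a function that permutes \<open>{1..N}\<close> (and is the identity elsewhere).
\<close>

record 'x rbpsc =
  num_sites :: nat
  num_active :: nat
  site_states :: "nat \<Rightarrow> 'x set"
  trans_prob :: "nat \<Rightarrow> nat \<Rightarrow> 'x \<Rightarrow> 'x \<Rightarrow> real"
  reward :: "nat \<Rightarrow> nat \<Rightarrow> 'x \<Rightarrow> real"
  switch_cost :: "nat \<Rightarrow> nat \<Rightarrow> real"
  init_dist :: "nat \<Rightarrow> 'x \<Rightarrow> real"
  init_site :: "nat \<Rightarrow> nat"
  discount :: real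

definition wf_rbpsc :: "'x rbpsc \<Rightarrow> bool" where
  "wf_rbpsc B \<longleftrightarrow>
     num_active B \<le> num_sites B \<and>
     (\<forall>n\<in>{1..num_sites B}. finite (site_states B n)) \<and>
     (\<forall>b\<in>{0,1}. \<forall>n\<in>{1..num_sites B}. \<forall>x\<in>site_states B n.
        (\<forall>y\<in>site_states B n. 0 \<le> trans_prob B b n x y) \<and>
        (\<Sum>y\<in>site_states B n. trans_prob B b n x y) = 1) \<and>
     (\<forall>n\<in>{1..num_sites B}.
        (\<forall>x\<in>site_states B n. 0 \<le> init_dist B n x) \<and>
        (\<Sum>x\<in>site_states B n. init_dist B n x) = 1) \<and>
     init_site B permutes {1..num_sites B} \<and>
     0 < discount B \<and> discount B < 1"

type_synonym 'x state = "(nat \<Rightarrow> 'x) \<times> (nat \<Rightarrow> nat)"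
type_synonym action = "nat \<Rightarrow> nat"

definition actions :: "'x rbpsc \<Rightarrow> action set" where
  "actions B = {a. a permutes {1..num_sites B}}"

definition system_states :: "'x rbpsc \<Rightarrow> 'x state set" where
  "system_states B = PiE {1..num_sites B} (site_states B) \<times> {s. s permutes {1..num_sites B}}"

definition total_reward :: "'x rbpsc \<Rightarrow> 'x state \<Rightarrow> action \<Rightarrow> real" where
  "total_reward B = (\<lambda>(x, s) a.
     (\<Sum>i=1..num_active B. reward B 1 (a i) (x (a i)) - switch_cost B (s i) (a i)) +
     (\<Sum>i=num_active B + 1..num_sites B. reward B 0 (a i) (x (a i))))"

definition site_trans_prob :: "'x rbpsc \<Rightarrow> (nat \<Rightarrow> 'x) \<Rightarrow> action \<Rightarrow> (nat \<Rightarrow> 'x) \<Rightarrow> real" where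
  "site_trans_prob B x a x' =
     (\<Prod>i=1..num_active B. trans_prob B 1 (a i) (x (a i)) (x' (a i))) *
     (\<Prod>i=num_active B + 1..num_sites B. trans_prob B 0 (a i) (x (a i)) (x' (a i)))"

definition next_prob :: "'x rbpsc \<Rightarrow> 'x state \<Rightarrow> action \<Rightarrow> 'x state \<Rightarrow> real" where
  "next_prob B = (\<lambda>(x, s) a (x', s'). if s' = a then site_trans_prob B x a x' else 0)"

definition init_prob :: "'x rbpsc \<Rightarrow> 'x state \<Rightarrow> real" where
  "init_prob B = (\<lambda>(x, s).
     \<Prod>i=1..num_sites B. init_dist B i (x i) * (if s i = init_site B i then 1 else 0))"

text \<open>
  A policy maps the list of past state-action pairs (oldest first) and the current state to a
  distribution on actions.
\<close>

type_synonym 'x policy = "('x state \<times> action) list \<Rightarrow> 'x state \<Rightarrow> action pmf"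

definition policies :: "'x rbpsc \<Rightarrow> 'x policy set" where
  "policies B = {\<pi>. \<forall>h z. set_pmf (\<pi> h z) \<subseteq> actions B}"

text \<open>
  The law of the process under a policy is the measure given by the Ionescu-Tulcea theorem for the
  kernels \<open>step_kernel\<close>: at step \<open>t\<close>, given the first \<open>t\<close> state-action pairs, the kernel draws the
  next state and then the action. Time starts at \<open>0\<close>.
\<close>

definition step_kernel ::
    "'x rbpsc \<Rightarrow> 'x policy \<Rightarrow> nat \<Rightarrow> (nat \<Rightarrow> 'x state \<times> action) \<Rightarrow> ('x state \<times> action) measure" where
  "step_kernel B \<pi> t \<omega> = point_measure (system_states B \<times> actions B) (\<lambda>(z, a). ennreal (
     (case t of 0 \<Rightarrow> init_prob B z
              | Suc t' \<Rightarrow> next_prob B (fst (\<omega> t')) (snd (\<omega> t')) z) *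
     pmf (\<pi> (map \<omega> [0..<t]) z) a))"

text \<open>
  These kernels satisfy the hypotheses of the Ionescu-Tulcea theorem, so \<open>path_measure\<close> below is
  the probability measure that the theorem provides.
\<close>

lemma finite_spaces:
  assumes "wf_rbpsc B"
  shows "finite (system_states B)" "finite (actions B)"
  using assms
  by (auto simp: wf_rbpsc_def system_states_def actions_def intro!: finite_PiE finite_permutations)

lemma init_prob_nonneg: "wf_rbpsc B \<Longrightarrow> z \<in> system_states B \<Longrightarrow> 0 \<le> init_prob B z"
  by (auto simp: wf_rbpsc_def system_states_def init_prob_def split: prod.splits intro!: prod_nonneg
      dest: PiE_mem)

lemma sum_init_prob:
  assumes wf: "wf_rbpsc B"
  shows "(\<Sum>z\<in>system_states B. init_prob B z) = 1"
proof -
  let ?N = "{1..num_sites B}"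
  let ?P = "{s. s permutes ?N}"
  have *: "(\<Prod>i\<in>?N. init_dist B i (x i) * (if s i = init_site B i then 1 else 0)) =
      (if s = init_site B then (\<Prod>i\<in>?N. init_dist B i (x i)) else 0)" if "s \<in> ?P" for x s
  proof (cases "s = init_site B")
    case False
    then obtain i where i: "s i \<noteq> init_site B i" by auto
    have "i \<in> ?N"
      using i that wf permutes_not_in[of s ?N i] permutes_not_in[of "init_site B" ?N i]
      unfolding wf_rbpsc_def by (metis mem_Collect_eq)
    then show ?thesis using i False by (auto intro!: prod_zero)
  qed auto
  have "(\<Sum>z\<in>system_states B. init_prob B z) =
     (\<Sum>x\<in>PiE ?N (site_states B). \<Sum>s\<in>?P. if s = init_site B then (\<Prod>i\<in>?N. init_dist B i (x i)) else 0)"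
    unfolding system_states_def init_prob_def sum.cartesian_product[symmetric]
    by (simp add: sum.cartesian_product) (auto intro!: sum.cong simp: *[simplified])
  also have "\<dots> = (\<Sum>x\<in>PiE ?N (site_states B). \<Prod>i\<in>?N. init_dist B i (x i))"
    using wf by (intro sum.cong refl) (auto simp: finite_permutations wf_rbpsc_def)
  also have "\<dots> = (\<Prod>i\<in>?N. \<Sum>x\<in>site_states B i. init_dist B i x)"
    using wf by (intro prod_sum_PiE[symmetric]) (auto simp: wf_rbpsc_def)
  also have "\<dots> = 1" using wf by (auto simp: wf_rbpsc_def)
  finally show ?thesis .
qed

lemma site_trans_prob_alt:
  assumes wf: "wf_rbpsc B" and a: "a \<in> actions B"
  shows "site_trans_prob B x a x' = (\<Prod>n=1..num_sites B.
     trans_prob B (if inv a n \<le> num_active B then 1 else 0) n (x n) (x' n))"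
proof -
  let ?N = "{1..num_sites B}"
  let ?b = "\<lambda>i. if i \<le> num_active B then 1 else 0 :: nat"
  have p: "a permutes ?N" using a by (simp add: actions_def)
  have "(\<Prod>n\<in>?N. trans_prob B (?b (inv a n)) n (x n) (x' n))
      = (\<Prod>i\<in>?N. trans_prob B (?b i) (a i) (x (a i)) (x' (a i)))"
    by (subst prod.permute[OF p]) (simp add: o_def permutes_inverses[OF p])
  also have "\<dots> = (\<Prod>i\<in>{1..num_active B} \<union> {num_active B + 1..num_sites B}.
      trans_prob B (?b i) (a i) (x (a i)) (x' (a i)))"
    using wf by (intro prod.cong) (auto simp: wf_rbpsc_def)
  also have "(\<Prod>i\<in>{1..num_active B} \<union> {num_active B + 1..num_sites B}. trans_prob B (?b i) (a i) (x (a i)) (x' (a i))) = site_trans_prob B x a x'"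
    unfolding site_trans_prob_def by (subst prod.union_disjoint) auto
  finally show ?thesis by simp
qed

lemma next_prob_nonneg:
  assumes "wf_rbpsc B" "z \<in> system_states B" "a \<in> actions B" "z' \<in> system_states B"
  shows "0 \<le> next_prob B z a z'"
  using assms
  by (auto simp: next_prob_def site_trans_prob_alt split: prod.splits intro!: prod_nonneg)
     (auto simp: wf_rbpsc_def system_states_def PiE_iff)

lemma sum_next_prob:
  assumes wf: "wf_rbpsc B" and z: "z \<in> system_states B" and a: "a \<in> actions B"
  shows "(\<Sum>z'\<in>system_states B. next_prob B z a z') = 1"
proof -
  let ?N = "{1..num_sites B}"
  obtain x s where zx: "z = (x, s)" by force
  let ?b = "\<lambda>i. if i \<le> num_active B then 1 else 0 :: nat"
  have "(\<Sum>z'\<in>system_states B. next_prob B z a z') =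
     (\<Sum>x'\<in>PiE ?N (site_states B). \<Sum>s'\<in>{s. s permutes ?N}. if s' = a then site_trans_prob B x a x' else 0)"
    unfolding system_states_def next_prob_def zx
    by (simp add: sum.cartesian_product)
  also have "\<dots> = (\<Sum>x'\<in>PiE ?N (site_states B). \<Prod>n\<in>?N. trans_prob B (?b (inv a n)) n (x n) (x' n))"
    using a by (intro sum.cong refl) (auto simp: finite_permutations actions_def site_trans_prob_alt[OF wf a])
  also have "\<dots> = (\<Prod>n\<in>?N. \<Sum>y\<in>site_states B n. trans_prob B (?b (inv a n)) n (x n) y)"
    using wf by (intro prod_sum_PiE[symmetric]) (auto simp: wf_rbpsc_def)
  also have "\<dots> = 1"
    using wf z by (intro prod.neutral) (auto simp: zx wf_rbpsc_def system_states_def PiE_iff)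
  finally show ?thesis .
qed

lemma Ionescu_Tulcea_step_kernel:
  assumes wf: "wf_rbpsc B" and pi: "\<pi> \<in> policies B"
  shows "Ionescu_Tulcea (step_kernel B \<pi>) (\<lambda>_. count_space (system_states B \<times> actions B))"
proof -
  let ?E = "system_states B \<times> actions B"
  note fin = finite_spaces[OF wf]
  have sp: "space (PiM {0..<i} (\<lambda>_. count_space ?E)) = PiE {0..<i} (\<lambda>_. ?E)" for i :: nat
    by (simp add: space_PiM)
  have ps: "prob_space (step_kernel B \<pi> i \<omega>)" if w: "\<omega> \<in> PiE {0..<i} (\<lambda>_. ?E)" for i \<omega>
  proof -
    define q where "q z = (case i of 0 \<Rightarrow> init_prob B z
              | Suc t' \<Rightarrow> next_prob B (fst (\<omega> t')) (snd (\<omega> t')) z)" for z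
    have w': "fst (\<omega> t) \<in> system_states B" "snd (\<omega> t) \<in> actions B" if "i = Suc t" for t
      using w that by (auto simp: PiE_iff mem_Times_iff)
    have q0: "0 \<le> q z" if "z \<in> system_states B" for z
      using that w' by (auto simp: q_def init_prob_nonneg[OF wf] next_prob_nonneg[OF wf] split: nat.splits)
    have q1: "(\<Sum>z\<in>system_states B. q z) = 1"
      using w' by (cases i) (auto simp: q_def sum_init_prob[OF wf] sum_next_prob[OF wf])
    have "(\<Sum>(z, a)\<in>?E. q z * pmf (\<pi> (map \<omega> [0..<i]) z) a) =
        (\<Sum>z\<in>system_states B. q z * (\<Sum>a\<in>actions B. pmf (\<pi> (map \<omega> [0..<i]) z) a))"
      by (simp add: sum.cartesian_product[symmetric] sum_distrib_left)
    also have "\<dots> = (\<Sum>z\<in>system_states B. q z)"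
      using pi fin by (intro sum.cong refl) (auto simp: policies_def sum_pmf_eq_1)
    finally have "(\<Sum>(z, a)\<in>?E. q z * pmf (\<pi> (map \<omega> [0..<i]) z) a) = 1"
      using q1 by simp
    then have "(\<Sum>w\<in>?E. ennreal (case w of (z, a) \<Rightarrow> q z * pmf (\<pi> (map \<omega> [0..<i]) z) a)) = 1"
      using q0 by (subst sum_ennreal) (auto split: prod.splits)
    then show ?thesis
      using fin unfolding step_kernel_def q_def[symmetric]
      by (intro prob_spaceI) (simp add: emeasure_point_measure_finite space_point_measure split_beta)
  qed
  show ?thesis
  proof (rule Ionescu_Tulcea.intro)
    fix i
    have [simp]: "sets (step_kernel B \<pi> i \<omega>) = Pow ?E" for \<omega>
      by (simp add: step_kernel_def sets_point_measure)
    show "step_kernel B \<pi> i \<in> PiM {0..<i} (\<lambda>_. count_space ?E) \<rightarrow>\<^sub>M subprob_algebra (count_space ?E)"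
      using fin ps[THEN prob_space_imp_subprob_space]
      by (subst count_space_PiM_finite)
         (simp_all add: space_subprob_algebra countable_finite Pi_iff)
  next
    fix i :: nat and \<omega>
    assume "\<omega> \<in> space (PiM {0..<i} (\<lambda>_. count_space ?E))"
    then show "prob_space (step_kernel B \<pi> i \<omega>)"
      unfolding sp by (rule ps)
  qed
qed

definition path_measure :: "'x rbpsc \<Rightarrow> 'x policy \<Rightarrow> (nat \<Rightarrow> 'x state \<times> action) measure" where
  "path_measure B \<pi> =
     (let E = (\<lambda>_::nat. count_space (system_states B \<times> actions B))
      in projective_family.lim UNIV (Ionescu_Tulcea.CI (step_kernel B \<pi>) E) E)"

definition expected_reward :: "'x rbpsc \<Rightarrow> 'x policy \<Rightarrow> real" where
  "expected_reward B \<pi> =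
     (\<integral>\<omega>. (\<Sum>t. discount B ^ t * total_reward B (fst (\<omega> t)) (snd (\<omega> t))) \<partial>path_measure B \<pi>)"

definition optimal_reward :: "'x rbpsc \<Rightarrow> ereal" where
  "optimal_reward B = (SUP \<pi>\<in>policies B. ereal (expected_reward B \<pi>))"

text \<open>
  The variables of the linear program are written \<open>u i s a x\<close> and \<open>v i s a x\<close>. Only the values
  with \<open>i, s, a \<in> {1..N}\<close>, and \<open>x \<in> S s\<close> for \<open>u\<close>, \<open>x \<in> S a\<close> for \<open>v\<close>, are ever used.
\<close>

type_synonym 'x lp_vars = "nat \<Rightarrow> nat \<Rightarrow> nat \<Rightarrow> 'x \<Rightarrow> real"

definition lp_objective :: "'x rbpsc \<Rightarrow> 'x lp_vars \<Rightarrow> real" where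
  "lp_objective B v =
     (\<Sum>s=1..num_sites B. \<Sum>a=1..num_sites B. \<Sum>x\<in>site_states B a.
        (reward B 1 a x - switch_cost B s a) * (\<Sum>i=1..num_active B. v i s a x) +
        reward B 0 a x * (\<Sum>i=num_active B + 1..num_sites B. v i s a x))"

definition lp_feasible :: "'x rbpsc \<Rightarrow> 'x lp_vars \<Rightarrow> 'x lp_vars \<Rightarrow> bool" where
  "lp_feasible B u v \<longleftrightarrow>
    (let N = num_sites B; M = num_active B; S = site_states B; \<alpha> = discount B;
         b = (\<lambda>i. if i \<le> M then 1 else 0 :: nat)
     in
      (\<forall>i\<in>{1..N}. \<forall>s\<in>{1..N}. \<forall>x\<in>S s. u i s s x = v i s s x) \<and>
      (\<forall>i\<in>{1..N}. \<forall>s\<in>{1..N}. \<forall>x\<in>S s.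
         (\<Sum>a=1..N. u i s a x) - \<alpha> * (\<Sum>y\<in>S s. \<Sum>s'=1..N. v i s' s y * trans_prob B (b i) s y x)
         = (1 - \<alpha>) * init_dist B s x * (if s = init_site B i then 1 else 0)) \<and>
      (\<forall>i\<in>{1..N}. \<forall>s\<in>{1..N}. \<forall>a\<in>{1..N}. (\<Sum>x\<in>S s. u i s a x) = (\<Sum>x\<in>S a. v i s a x)) \<and>
      (\<forall>j\<in>{1..N}. \<forall>x\<in>S j.
         (\<Sum>i=1..N. \<Sum>a=1..N. u i j a x) = (\<Sum>i=1..N. \<Sum>s=1..N. v i s j x)) \<and>
      (\<forall>i\<in>{1..N}. \<forall>a'\<in>{1..N}.
         (\<Sum>s=1..N. \<Sum>x\<in>S s. \<Sum>a\<in>{1..N} - {a'}. u i s a x)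
         = (\<Sum>k\<in>{1..N} - {i}. \<Sum>s=1..N. \<Sum>x\<in>S s. u k s a' x)) \<and>
      (\<forall>i\<in>{1..N}. \<forall>s'\<in>{1..N}.
         (\<Sum>a=1..N. \<Sum>x\<in>S a. \<Sum>s\<in>{1..N} - {s'}. v i s a x)
         = (\<Sum>k\<in>{1..N} - {i}. \<Sum>a=1..N. \<Sum>x\<in>S a. v k s' a x)) \<and>
      (\<forall>i\<in>{1..N}. \<forall>s\<in>{1..N}. \<forall>a\<in>{1..N}.
         (\<forall>x\<in>S s. 0 \<le> u i s a x) \<and> (\<forall>x\<in>S a. 0 \<le> v i s a x)))"

definition lp_value :: "'x rbpsc \<Rightarrow> ereal" where
  "lp_value B = (SUP (u, v)\<in>{(u, v). lp_feasible B u v}. ereal (lp_objective B v))"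

end

theory Submission
  imports Defs
begin

text \<open>
  For a fixed policy, let \<open>\<mu> (z, a)\<close> be the normalized discounted frequency with which the pair
  \<open>(z, a)\<close> of a system state and an action is visited. The law of the process gives
  \<open>\<Sum>a. \<mu> (z, a) = (1 - \<alpha>) * init z + \<alpha> * (\<Sum>w. \<mu> w * next w z)\<close>, and the normalized reward of
  the policy is the \<open>\<mu>\<close>-integral of the immediate reward. The linear program sees only the image of
  \<open>\<mu>\<close> under \<open>((y, \<sigma>), \<tau>) \<mapsto> (\<sigma> i, \<tau> i, y (\<sigma> i))\<close> for \<open>u\<close> and
  \<open>((y, \<sigma>), \<tau>) \<mapsto> (\<sigma> i, \<tau> i, y (\<tau> i))\<close> for \<open>v\<close>. Every constraint except (1) is the \<open>\<mu>\<close>-integral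
  of an identity between indicators that holds for any two permutations \<open>\<sigma>\<close>, \<open>\<tau>\<close>; constraint (1) is the
  balance equation summed over all coordinates but the one of site \<open>s\<close>.
\<close>

section \<open>Coordinates of the Ionescu-Tulcea measure\<close>

context Ionescu_Tulcea
begin

text \<open>\<open>CI J\<close> is the image of \<open>C\<close> under restriction to the
  coordinates in \<open>J\<close>. For an initial segment nothing is cut off, so the embedding of a
  measurable set is the set itself.\<close>

lemma CI_initial_segment: "CI {0..<n} = C 0 n (\<lambda>_. undefined)"
proof (rule measure_eqI)
  fix X assume "X \<in> sets (CI {0..<n})"
  then have X: "X \<in> sets (PiM {0..<n} M)" by (simp add: CI_def)
  show "emeasure (CI {0..<n}) X = emeasure (C 0 n (\<lambda>_. undefined)) X"
    using emeasure_CI[OF subset_refl X] X[THEN sets.sets_into_space]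
    by (simp add: prod_emb_id space_PiM)
qed (simp add: CI_def sets_C)

text \<open>The marginal of the projective limit on a finite index set is the corresponding
  \<open>CI\<close>, so a function of the first \<open>n\<close> coordinates can be integrated
  against the finite-stage measure \<open>C 0 n\<close>.\<close>

lemma nn_integral_lim_initial_segment:
  assumes [measurable]: "f \<in> borel_measurable (PiM {0..<n} M)"
  shows "(\<integral>\<^sup>+\<omega>. f (restrict \<omega> {0..<n}) \<partial>PF.lim) = (\<integral>\<^sup>+\<omega>. f \<omega> \<partial>C 0 n (\<lambda>_. undefined))"
proof -
  have "(\<lambda>\<omega>. restrict \<omega> {0..<n}) \<in> PF.lim \<rightarrow>\<^sub>M PiM {0..<n} M"
    by (subst measurable_cong_sets[OF PF.sets_lim refl]) (rule measurable_restrict_subset, simp)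
  then show ?thesis
    unfolding CI_initial_segment[symmetric] distr_lim[OF finite_atLeastLessThan, symmetric]
    by (subst nn_integral_distr) simp_all
qed

text \<open>Disintegration at time \<open>n\<close>: stage \<open>Suc n\<close> binds stage
  \<open>n\<close> to \<open>eP n\<close>, which appends a draw from \<open>P n\<close>. Since
  \<open>f\<close> reads only the new coordinate, only that draw remains in the inner
  integral.\<close>

lemma nn_integral_lim_component:
  assumes [measurable]: "f \<in> borel_measurable (M n)"
  shows "(\<integral>\<^sup>+\<omega>. f (\<omega> n) \<partial>PF.lim) = (\<integral>\<^sup>+\<omega>. (\<integral>\<^sup>+x. f x \<partial>P n (restrict \<omega> {0..<n})) \<partial>PF.lim)"
proof -
  \<comment> \<open>\<open>undefined\<close> is the empty history, the only point of the product
    over no coordinates.\<close>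
  have [simp]: "(\<lambda>_. undefined) \<in> space (PiM {0..<0} M)" by (simp add: space_PiM)
  have [measurable]: "(\<lambda>\<omega>. f (\<omega> n)) \<in> borel_measurable (PiM {0..<Suc n} M)"
    by (rule measurable_compose[OF _ assms]) (rule measurable_component_singleton, simp)
  have "(\<integral>\<^sup>+\<omega>. f (\<omega> n) \<partial>PF.lim) = (\<integral>\<^sup>+\<omega>. f (restrict \<omega> {0..<Suc n} n) \<partial>PF.lim)"
    by simp
  also have "\<dots> = (\<integral>\<^sup>+\<omega>. f (\<omega> n) \<partial>C 0 (Suc n) (\<lambda>_. undefined))"
    by (rule nn_integral_lim_initial_segment) measurable
  also have "\<dots> = (\<integral>\<^sup>+\<omega>. (\<integral>\<^sup>+\<omega>'. f (\<omega>' n) \<partial>eP n \<omega>) \<partial>C 0 n (\<lambda>_. undefined))"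
    using measurable_eP[of n]
    by (simp add: nn_integral_bind[where B="PiM {0..<Suc n} M"] measurable_cong_sets[OF sets_C refl])
  also have "\<dots> = (\<integral>\<^sup>+\<omega>. (\<integral>\<^sup>+x. f x \<partial>P n \<omega>) \<partial>C 0 n (\<lambda>_. undefined))"
    by (intro nn_integral_cong) (simp add: space_C nn_integral_eP)
  also have "\<dots> = (\<integral>\<^sup>+\<omega>. (\<integral>\<^sup>+x. f x \<partial>P n (restrict \<omega> {0..<n})) \<partial>PF.lim)"
    by (rule nn_integral_lim_initial_segment[symmetric])
       (rule measurable_compose[OF P nn_integral_measurable_subprob_algebra], measurable)
  finally show ?thesis .
qed

text \<open>The total mass is read off from the empty initial segment, since \<open>C 0 0\<close> is
  a probability measure.\<close>

lemma prob_space_lim: "prob_space PF.lim"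
proof
  have "emeasure PF.lim (space PF.lim) = (\<integral>\<^sup>+\<omega>. 1 \<partial>PF.lim)" by simp
  also have "\<dots> = (\<integral>\<^sup>+\<omega>. 1 \<partial>C 0 0 (\<lambda>_. undefined))"
    by (rule nn_integral_lim_initial_segment[where f = "\<lambda>_. 1"]) simp
  also have "\<dots> = 1"
    by (subst nn_integral_const) (simp add: prob_space.emeasure_space_1 prob_space_C del: C.simps)
  finally show "emeasure PF.lim (space PF.lim) = 1" .
qed

end

section \<open>One-time laws of the process under a fixed policy\<close>

locale rbpsc_policy =
  fixes B :: "'x rbpsc" and \<pi> :: "'x policy"
  assumes wf: "wf_rbpsc B" and policy: "\<pi> \<in> policies B"
begin

abbreviation "pairs \<equiv> system_states B \<times> actions B"

sublocale IT: Ionescu_Tulcea "step_kernel B \<pi>" "\<lambda>_. count_space pairs"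
  by (rule Ionescu_Tulcea_step_kernel[OF wf policy])

lemma path_measure_eq_lim: "path_measure B \<pi> = IT.PF.lim"
  by (simp add: path_measure_def Let_def)

sublocale path: prob_space "path_measure B \<pi>"
  unfolding path_measure_eq_lim by (rule IT.prob_space_lim)

lemma finite_pairs: "finite pairs"
  using finite_spaces[OF wf] by simp

lemma space_path: "space (path_measure B \<pi>) = (UNIV \<rightarrow>\<^sub>E pairs)"
  by (simp add: path_measure_eq_lim space_PiM)

lemma measurable_component: "(\<lambda>\<omega>. \<omega> t) \<in> path_measure B \<pi> \<rightarrow>\<^sub>M count_space pairs"
  unfolding path_measure_eq_lim
  by (subst measurable_cong_sets[OF IT.PF.sets_lim refl]) (rule measurable_component_singleton, simp)

lemma measurable_fun_component: "(\<lambda>\<omega>. f (\<omega> t) :: real) \<in> borel_measurable (path_measure B \<pi>)"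
  by (rule measurable_compose[OF measurable_component]) simp

text \<open>Although the policy may use the whole history, these one-time laws suffice: the reward
  and the law of the next state depend only on the current pair.\<close>

definition occ :: "nat \<Rightarrow> 'x state \<times> action \<Rightarrow> real" where
  "occ t w = measure (path_measure B \<pi>) {\<omega>\<in>space (path_measure B \<pi>). \<omega> t = w}"

lemma occ_nonneg: "0 \<le> occ t w" and occ_le_1: "occ t w \<le> 1"
  by (simp_all add: occ_def)

lemma integrable_component:
  fixes f :: "'x state \<times> action \<Rightarrow> real"
  shows "integrable (path_measure B \<pi>) (\<lambda>\<omega>. f (\<omega> t))"
proof (rule path.integrable_const_bound)
  show "AE \<omega> in path_measure B \<pi>. norm (f (\<omega> t)) \<le> (\<Sum>w\<in>pairs. \<bar>f w\<bar>)"
    using finite_pairs by (intro AE_I2) (auto simp: space_path PiE_iff intro!: member_le_sum)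
qed (rule measurable_fun_component)

lemma integral_component:
  fixes f :: "'x state \<times> action \<Rightarrow> real"
  shows "(\<integral>\<omega>. f (\<omega> t) \<partial>path_measure B \<pi>) = (\<Sum>w\<in>pairs. f w * occ t w)"
proof -
  let ?A = "\<lambda>w. {\<omega>\<in>space (path_measure B \<pi>). \<omega> t = w}"
  have A: "?A w \<in> sets (path_measure B \<pi>)" if "w \<in> pairs" for w
    using measurable_sets[OF measurable_component, of "{w}" t] that
    by (simp add: vimage_def Int_def conj_commute)
  have "(\<integral>\<omega>. f (\<omega> t) \<partial>path_measure B \<pi>) = (\<integral>\<omega>. (\<Sum>w\<in>pairs. f w * indicator (?A w) \<omega>) \<partial>path_measure B \<pi>)"
  proof (rule Bochner_Integration.integral_cong[OF refl])
    fix \<omega> assume \<omega>: "\<omega> \<in> space (path_measure B \<pi>)"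
    then have "\<omega> t \<in> pairs" by (simp add: space_path PiE_iff)
    have "(\<Sum>w\<in>pairs. f w * indicator (?A w) \<omega>) = (\<Sum>w\<in>pairs. if w = \<omega> t then f w else 0)"
      using \<omega> by (intro sum.cong) (auto simp: indicator_def)
    then show "f (\<omega> t) = (\<Sum>w\<in>pairs. f w * indicator (?A w) \<omega>)"
      using finite_pairs \<open>\<omega> t \<in> pairs\<close> by simp
  qed
  also have "\<dots> = (\<Sum>w\<in>pairs. f w * occ t w)"
    using A by (subst Bochner_Integration.integral_sum)
      (auto simp: occ_def path.emeasure_eq_measure intro!: sum.cong)
  finally show ?thesis .
qed

lemma nn_integral_component:
  fixes f :: "'x state \<times> action \<Rightarrow> real"
  assumes "\<And>w. w \<in> pairs \<Longrightarrow> 0 \<le> f w"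
  shows "(\<integral>\<^sup>+\<omega>. ennreal (f (\<omega> t)) \<partial>path_measure B \<pi>) = ennreal (\<Sum>w\<in>pairs. f w * occ t w)"
proof (subst nn_integral_eq_integral[OF integrable_component])
  show "AE \<omega> in path_measure B \<pi>. 0 \<le> f (\<omega> t)"
    by (intro AE_I2 assms) (simp only: space_path PiE_iff UNIV_I)
qed (simp add: integral_component)

text \<open>Summing out the action removes the policy, whose probabilities add up to 1 on
  \<open>actions B\<close>. What is left of the history is the last pair, inside
  \<open>q\<close>.\<close>

lemma nn_integral_step_kernel:
  assumes q: "\<And>z. z \<in> system_states B \<Longrightarrow> 0 \<le> q z"
    and q_def: "\<And>z. q z = (case t of 0 \<Rightarrow> init_prob B z
              | Suc t' \<Rightarrow> next_prob B (fst (\<omega> t')) (snd (\<omega> t')) z)"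
    and z: "z \<in> system_states B"
  shows "(\<integral>\<^sup>+w. ennreal (of_bool (fst w = z)) \<partial>step_kernel B \<pi> t \<omega>) = ennreal (q z)"
proof -
  define p where "p z' = \<pi> (map \<omega> [0..<t]) z'" for z'
  have "(\<integral>\<^sup>+w. ennreal (of_bool (fst w = z)) \<partial>step_kernel B \<pi> t \<omega>)
      = (\<Sum>w\<in>pairs. ennreal (case w of (z, a) \<Rightarrow> q z * pmf (p z) a) * ennreal (of_bool (fst w = z)))"
    unfolding step_kernel_def q_def[symmetric] p_def[symmetric]
    using finite_pairs by (subst nn_integral_point_measure_finite) (simp_all add: split_beta)
  also have "\<dots> = (\<Sum>w\<in>pairs. ennreal (q (fst w) * pmf (p (fst w)) (snd w) * of_bool (fst w = z)))"
    using q by (intro sum.cong refl) (auto simp: ennreal_mult' split: prod.splits)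
  also have "\<dots> = ennreal (\<Sum>w\<in>pairs. q (fst w) * pmf (p (fst w)) (snd w) * of_bool (fst w = z))"
    using q by (intro sum_ennreal) auto
  also have "(\<Sum>w\<in>pairs. q (fst w) * pmf (p (fst w)) (snd w) * of_bool (fst w = z))
      = (\<Sum>z'\<in>system_states B. if z' = z then q z' * (\<Sum>a\<in>actions B. pmf (p z') a) else 0)"
    unfolding sum.cartesian_product' by (intro sum.cong refl) (simp add: sum_distrib_left)
  also have "\<dots> = q z * (\<Sum>a\<in>actions B. pmf (p z) a)"
    using z finite_spaces[OF wf] by simp
  also have "(\<Sum>a\<in>actions B. pmf (p z) a) = 1"
    using policy finite_spaces[OF wf] by (intro sum_pmf_eq_1) (auto simp: policies_def p_def simp del: split_paired_All)
  finally show ?thesis by simp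
qed

lemma nn_integral_state:
  assumes z: "z \<in> system_states B"
  shows "(\<integral>\<^sup>+\<omega>. ennreal (of_bool (fst (\<omega> t) = z)) \<partial>path_measure B \<pi>) = ennreal (\<Sum>a\<in>actions B. occ t (z, a))"
proof -
  have "(\<Sum>w\<in>pairs. of_bool (fst w = z) * occ t w)
      = (\<Sum>z'\<in>system_states B. if z' = z then (\<Sum>a\<in>actions B. occ t (z', a)) else 0)"
    unfolding sum.cartesian_product' by (intro sum.cong refl) simp
  also have "\<dots> = (\<Sum>a\<in>actions B. occ t (z, a))"
    using z finite_spaces[OF wf] by simp
  finally show ?thesis by (subst nn_integral_component) simp_all
qed

lemma nn_integral_state_step:
  "(\<integral>\<^sup>+\<omega>. ennreal (of_bool (fst (\<omega> t) = z)) \<partial>path_measure B \<pi>)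
    = (\<integral>\<^sup>+\<omega>. (\<integral>\<^sup>+w. ennreal (of_bool (fst w = z)) \<partial>step_kernel B \<pi> t (restrict \<omega> {0..<t})) \<partial>path_measure B \<pi>)"
  unfolding path_measure_eq_lim by (rule IT.nn_integral_lim_component) simp

lemma occ_0:
  assumes z: "z \<in> system_states B"
  shows "(\<Sum>a\<in>actions B. occ 0 (z, a)) = init_prob B z"
proof -
  have "ennreal (\<Sum>a\<in>actions B. occ 0 (z, a)) = (\<integral>\<^sup>+\<omega>. ennreal (init_prob B z) \<partial>path_measure B \<pi>)"
    unfolding nn_integral_state[OF z, symmetric] nn_integral_state_step
    by (intro nn_integral_cong nn_integral_step_kernel[where q = "init_prob B"])
       (auto simp: init_prob_nonneg[OF wf] z)
  also have "\<dots> = ennreal (init_prob B z)"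
    by (simp add: path.emeasure_space_1)
  finally show ?thesis
    using init_prob_nonneg[OF wf z] by (simp add: sum_nonneg occ_nonneg)
qed

text \<open>Given the history, the next state depends only on the pair at time \<open>t\<close>, so
  averaging over paths reduces to averaging over \<open>occ t\<close>.\<close>

lemma occ_Suc:
  assumes z: "z \<in> system_states B"
  shows "(\<Sum>a\<in>actions B. occ (Suc t) (z, a)) = (\<Sum>w\<in>pairs. occ t w * next_prob B (fst w) (snd w) z)"
proof -
  have nonneg: "0 \<le> next_prob B (fst w) (snd w) z" if "w \<in> pairs" for w
    using that z by (auto intro: next_prob_nonneg[OF wf])
  have "ennreal (\<Sum>a\<in>actions B. occ (Suc t) (z, a))
      = (\<integral>\<^sup>+\<omega>. ennreal (next_prob B (fst (\<omega> t)) (snd (\<omega> t)) z) \<partial>path_measure B \<pi>)"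
    unfolding nn_integral_state[OF z, symmetric] nn_integral_state_step
  \<comment> \<open>The history restricted to \<open>{0..<Suc t}\<close> still contains coordinate
    \<open>t\<close>, the only one that the probability of the next state reads.\<close>
  proof (intro nn_integral_cong nn_integral_step_kernel[where q = "next_prob B _ _"])
    fix \<omega> z' assume "\<omega> \<in> space (path_measure B \<pi>)" "z' \<in> system_states B"
    then show "0 \<le> next_prob B (fst (\<omega> t)) (snd (\<omega> t)) z'"
      by (intro next_prob_nonneg[OF wf]) (auto simp: space_path PiE_iff mem_Times_iff)
  qed (auto simp: z)
  also have "\<dots> = ennreal (\<Sum>w\<in>pairs. next_prob B (fst w) (snd w) z * occ t w)"
    using nonneg by (rule nn_integral_component)
  finally show ?thesis
    using nonneg by (simp add: sum_nonneg occ_nonneg mult.commute)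
qed

section \<open>The discounted occupation measure\<close>

text \<open>Each \<open>occ t\<close> has total mass 1 on \<open>pairs\<close>, so the factor
  \<open>1 - discount B\<close> makes this a probability distribution; it is also the source of the
  factor in the final bound.\<close>

definition disc_occ :: "'x state \<times> action \<Rightarrow> real" where
  "disc_occ w = (1 - discount B) * (\<Sum>t. discount B ^ t * occ t w)"

lemma discount: "0 < discount B" "discount B < 1"
  using wf by (simp_all add: wf_rbpsc_def)

lemma summable_occ: "summable (\<lambda>t. discount B ^ t * occ t w)"
  using discount
  by (intro summable_comparison_test'[OF summable_geometric[of "discount B"]])
     (auto simp: occ_nonneg occ_le_1 abs_mult intro!: mult_left_le)

lemma disc_occ_nonneg: "0 \<le> disc_occ w"
  using discount unfolding disc_occ_def
  by (intro mult_nonneg_nonneg suminf_nonneg summable_occ) (auto simp: occ_nonneg)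

text \<open>The one-step recursion for \<open>occ\<close>, weighted by the powers of the discount
  and summed over time: the term at time 0 gives the initial law, and the shift of the remaining
  series by one step gives the factor \<open>discount B\<close>.\<close>

lemma disc_occ_balance:
  assumes z: "z \<in> system_states B"
  shows "(\<Sum>a\<in>actions B. disc_occ (z, a)) = (1 - discount B) * init_prob B z +
    discount B * (\<Sum>w\<in>pairs. disc_occ w * next_prob B (fst w) (snd w) z)"
proof -
  define F where "F t = discount B ^ t * (\<Sum>a\<in>actions B. occ t (z, a))" for t
  have F: "F t = (\<Sum>a\<in>actions B. discount B ^ t * occ t (z, a))" for t
    by (simp add: F_def sum_distrib_left)
  have sF: "summable F"
    unfolding F by (intro summable_sum summable_occ)
  have FSuc: "F (Suc t) = discount B * (\<Sum>w\<in>pairs. next_prob B (fst w) (snd w) z * (discount B ^ t * occ t w))" for t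
    unfolding F_def occ_Suc[OF z] by (simp add: sum_distrib_left mult_ac)
  have "(\<Sum>a\<in>actions B. disc_occ (z, a)) = (1 - discount B) * (\<Sum>t. F t)"
    unfolding disc_occ_def F by (subst suminf_sum) (auto simp: summable_occ sum_distrib_left)
  also have "(\<Sum>t. F t) = F 0 + (\<Sum>t. F (Suc t))"
    using suminf_split_head[OF sF] by simp
  also have "F 0 = init_prob B z"
    by (simp add: F_def occ_0[OF z])
  also have "(\<Sum>t. F (Suc t)) = discount B * (\<Sum>w\<in>pairs. next_prob B (fst w) (snd w) z * (\<Sum>t. discount B ^ t * occ t w))"
    unfolding FSuc
    by (subst suminf_mult) (auto simp: suminf_sum suminf_mult summable_occ intro!: summable_sum summable_mult)
  finally show ?thesis
    by (simp add: disc_occ_def algebra_simps sum_distrib_left)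
qed

lemma expected_reward_disc_occ:
  "(1 - discount B) * expected_reward B \<pi> = (\<Sum>w\<in>pairs. disc_occ w * (case w of (z, a) \<Rightarrow> total_reward B z a))"
proof -
  define R where "R = (\<lambda>w. total_reward B (fst w) (snd w))"
  \<comment> \<open>The set of pairs is finite, so \<open>K\<close> bounds every immediate reward,
    and \<open>discount B ^ t * K\<close> dominates the discounted reward at time
    \<open>t\<close>.\<close>
  define K where "K = (\<Sum>w\<in>pairs. \<bar>R w\<bar>)"
  have K: "\<bar>R (\<omega> t)\<bar> \<le> K" if "\<omega> \<in> space (path_measure B \<pi>)" for \<omega> t
    using that finite_pairs unfolding K_def space_path by (intro member_le_sum) (auto simp: PiE_iff)
  have sK: "summable (\<lambda>t. discount B ^ t * K)"
    using discount by (intro summable_mult2 summable_geometric) auto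
  have "expected_reward B \<pi> = (\<Sum>t. \<integral>\<omega>. discount B ^ t * R (\<omega> t) \<partial>path_measure B \<pi>)"
    unfolding expected_reward_def R_def[symmetric]
  \<comment> \<open>Expectation and series may be exchanged because both the pathwise series and the
    series of integrals of norms are dominated by this geometric series.\<close>
  proof (subst integral_suminf[symmetric])
    show "integrable (path_measure B \<pi>) (\<lambda>\<omega>. discount B ^ t * R (\<omega> t))" for t
      by (intro integrable_mult_right integrable_component)
    show "AE \<omega> in path_measure B \<pi>. summable (\<lambda>t. norm (discount B ^ t * R (\<omega> t)))"
      using discount K
      by (intro AE_I2 summable_comparison_test'[OF sK]) (auto simp: abs_mult intro!: mult_left_mono)
    have "(\<integral>\<omega>. norm (discount B ^ t * R (\<omega> t)) \<partial>path_measure B \<pi>) \<le> discount B ^ t * K" for t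
      using discount K
      by (intro path.integral_le_const integrable_norm integrable_mult_right integrable_component AE_I2)
         (auto simp: abs_mult intro!: mult_left_mono)
    then show "summable (\<lambda>t. \<integral>\<omega>. norm (discount B ^ t * R (\<omega> t)) \<partial>path_measure B \<pi>)"
      by (intro summable_comparison_test'[OF sK]) auto
  qed (simp add: R_def)
  also have "\<dots> = (\<Sum>t. \<Sum>w\<in>pairs. R w * (discount B ^ t * occ t w))"
    by (simp add: integral_component sum_distrib_left mult_ac)
  also have "\<dots> = (\<Sum>w\<in>pairs. R w * (\<Sum>t. discount B ^ t * occ t w))"
    by (simp add: suminf_sum suminf_mult summable_occ summable_mult)
  finally show ?thesis
    by (simp add: R_def disc_occ_def sum_distrib_left split_beta mult_ac)
qed

end

section \<open>The linear program of an occupation measure\<close>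

text \<open>Indicators are kept as left factors of this shape, so that each sum over a site, a state
  or a permutation collapses by one rewriting.\<close>

lemma sum_of_bool_times:
  fixes f :: "'a \<Rightarrow> real"
  assumes "finite A" "c \<in> A"
  shows "(\<Sum>a\<in>A. of_bool (c = a) * f a) = f c"
  using assms by (simp add: of_bool_def if_distrib[of "\<lambda>r. r * _"] cong: if_cong)

text \<open>This is a marginal of a product distribution: all factors except the one at
  \<open>k\<close> sum to 1.\<close>

lemma sum_PiE_prod_of_bool:
  fixes f :: "'i \<Rightarrow> 'a \<Rightarrow> real"
  assumes fin: "finite I" "\<And>n. n \<in> I \<Longrightarrow> finite (S n)" and k: "k \<in> I" and x: "x \<in> S k"
    and one: "\<And>n. n \<in> I \<Longrightarrow> (\<Sum>y\<in>S n. f n y) = 1"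
  shows "(\<Sum>g\<in>PiE I S. (\<Prod>n\<in>I. f n (g n)) * of_bool (g k = x)) = f k x"
proof -
  \<comment> \<open>Putting the indicator into factor \<open>k\<close> keeps the summand a product
    over \<open>I\<close>, so that the sum over \<open>PiE I S\<close> factorizes.\<close>
  define c where "c n y = (if n = k then of_bool (x = y) else 1 :: real)" for n y
  have "(\<Sum>g\<in>PiE I S. (\<Prod>n\<in>I. f n (g n)) * of_bool (g k = x))
      = (\<Sum>g\<in>PiE I S. \<Prod>n\<in>I. c n (g n) * f n (g n))"
    using fin k by (intro sum.cong refl) (auto simp: prod.distrib c_def prod.If_cases)
  also have "\<dots> = (\<Prod>n\<in>I. \<Sum>y\<in>S n. c n y * f n y)"
    using fin by (intro prod_sum_PiE[symmetric])
  also have "\<dots> = (\<Sum>y\<in>S k. of_bool (x = y) * f k y) * (\<Prod>n\<in>I - {k}. \<Sum>y\<in>S n. f n y)"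
    using fin k by (subst prod.remove[of _ k]) (auto simp: c_def)
  also have "\<dots> = f k x"
    using fin k x one by (simp add: sum_of_bool_times)
  finally show ?thesis .
qed

section \<open>Marginals of the initial and transition laws\<close>

lemma sum_init_prob_marginal:
  assumes wf: "wf_rbpsc B" and s: "s \<in> {1..num_sites B}" and x: "x \<in> site_states B s"
  shows "(\<Sum>z\<in>system_states B. init_prob B z * (of_bool (snd z i = s) * of_bool (fst z s = x)))
    = init_dist B s x * of_bool (init_site B i = s)"
proof -
  let ?N = "{1..num_sites B}"
  let ?P = "{\<sigma>. \<sigma> permutes ?N}"
  have perm: "init_site B \<in> ?P"
    using wf by (simp add: wf_rbpsc_def)
  have init: "init_prob B (y, \<sigma>) = of_bool (init_site B = \<sigma>) * (\<Prod>n\<in>?N. init_dist B n (y n))"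
    if "\<sigma> \<in> ?P" for y \<sigma>
  proof (cases "\<sigma> = init_site B")
    case False
    \<comment> \<open>Both permutations are the identity off the sites, so they differ at a site,
      where \<open>init_prob\<close> has a zero factor.\<close>
    then obtain n where n: "\<sigma> n \<noteq> init_site B n" by auto
    then have "n \<in> ?N"
      using that perm by (metis mem_Collect_eq permutes_not_in)
    then have "init_prob B (y, \<sigma>) = 0"
      using n by (auto simp: init_prob_def intro!: prod_zero)
    then show ?thesis using False by simp
  qed (simp add: init_prob_def)
  have "(\<Sum>z\<in>system_states B. init_prob B z * (of_bool (snd z i = s) * of_bool (fst z s = x)))
    = (\<Sum>y\<in>PiE ?N (site_states B). \<Sum>\<sigma>\<in>?P. of_bool (init_site B = \<sigma>) *
        (of_bool (\<sigma> i = s) * ((\<Prod>n\<in>?N. init_dist B n (y n)) * of_bool (y s = x))))"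
    unfolding system_states_def
    by (subst sum.cartesian_product) (intro sum.cong refl, auto simp: init)
  also have "\<dots> = of_bool (init_site B i = s) *
      (\<Sum>y\<in>PiE ?N (site_states B). (\<Prod>n\<in>?N. init_dist B n (y n)) * of_bool (y s = x))"
    using perm finite_permutations[of ?N] by (simp only: sum_of_bool_times finite_atLeastAtMost sum_distrib_left)
  also have "\<dots> = of_bool (init_site B i = s) * init_dist B s x"
    using wf s x by (subst sum_PiE_prod_of_bool) (auto simp: wf_rbpsc_def)
  finally show ?thesis by simp
qed

text \<open>The action is the next placement, and given the action the sites move independently. So
  only the matrix of site \<open>s\<close> survives, and whether it is the active one is decided by
  agent \<open>i\<close> alone.\<close>

lemma sum_next_prob_marginal:
  assumes wf: "wf_rbpsc B" and z: "z \<in> system_states B" and a: "a \<in> actions B"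
    and s: "s \<in> {1..num_sites B}" and x: "x \<in> site_states B s"
  shows "(\<Sum>z'\<in>system_states B. next_prob B z a z' * (of_bool (snd z' i = s) * of_bool (fst z' s = x)))
    = of_bool (a i = s) * trans_prob B (if i \<le> num_active B then 1 else 0) s (fst z s) x"
proof -
  let ?N = "{1..num_sites B}"
  let ?P = "{\<sigma>. \<sigma> permutes ?N}"
  let ?b = "\<lambda>i. if i \<le> num_active B then 1 else 0 :: nat"
  obtain y \<sigma> where zy: "z = (y, \<sigma>)" by force
  have p: "a permutes ?N" using a by (simp add: actions_def)
  \<comment> \<open>The product over sites selects the matrix by the agent \<open>inv a s\<close>;
    on the event \<open>a i = s\<close> this agent is \<open>i\<close>.\<close>
  have inv: "inv a s = i" if "a i = s"
    using that permutes_inverses(2)[OF p] by auto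
  have "(\<Sum>z'\<in>system_states B. next_prob B z a z' * (of_bool (snd z' i = s) * of_bool (fst z' s = x)))
    = (\<Sum>y'\<in>PiE ?N (site_states B). \<Sum>\<sigma>'\<in>?P. of_bool (a = \<sigma>') *
        (of_bool (\<sigma>' i = s) * ((\<Prod>n\<in>?N. trans_prob B (?b (inv a n)) n (y n) (y' n)) * of_bool (y' s = x))))"
    unfolding system_states_def
    by (subst sum.cartesian_product)
       (intro sum.cong refl, auto simp: next_prob_def zy site_trans_prob_alt[OF wf a])
  also have "\<dots> = of_bool (a i = s) *
      (\<Sum>y'\<in>PiE ?N (site_states B). (\<Prod>n\<in>?N. trans_prob B (?b (inv a n)) n (y n) (y' n)) * of_bool (y' s = x))"
    using p finite_permutations[of ?N]
    by (simp only: sum_of_bool_times finite_atLeastAtMost sum_distrib_left mem_Collect_eq)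
  also have "\<dots> = of_bool (a i = s) * trans_prob B (?b (inv a s)) s (y s) x"
    using wf s x z by (subst sum_PiE_prod_of_bool) (auto simp: wf_rbpsc_def zy system_states_def PiE_iff)
  finally show ?thesis using inv by (auto simp: zy)
qed

section \<open>Feasible points from solutions of the balance equations\<close>

text \<open>The policy enters only through the balance equations, so the construction is carried out
  for any nonnegative solution of them.\<close>

locale occupation =
  fixes B :: "'x rbpsc" and \<mu> :: "'x state \<times> action \<Rightarrow> real"
  assumes wf: "wf_rbpsc B"
    and nonneg: "\<And>w. w \<in> system_states B \<times> actions B \<Longrightarrow> 0 \<le> \<mu> w"
    and balance: "\<And>z. z \<in> system_states B \<Longrightarrow> (\<Sum>a\<in>actions B. \<mu> (z, a)) =
      (1 - discount B) * init_prob B z +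
      discount B * (\<Sum>w\<in>system_states B \<times> actions B. \<mu> w * next_prob B (fst w) (snd w) z)"
begin

text \<open>This keeps \<open>{1..n}\<close> intact and stops the simplifier from turning sums of
  indicators into cardinalities or sums over intersections.\<close>

declare One_nat_def [simp del] sum_of_bool_eq [simp del] sum_of_bool_mult_eq [simp del]

abbreviation "sites \<equiv> {1..num_sites B}"

definition mean :: "('x state \<times> action \<Rightarrow> real) \<Rightarrow> real" where
  "mean f = (\<Sum>w\<in>system_states B \<times> actions B. \<mu> w * f w)"

lemma mean_cong:
  assumes "\<And>y \<sigma> \<tau>. y \<in> PiE sites (site_states B) \<Longrightarrow> \<sigma> permutes sites \<Longrightarrow> \<tau> permutes sites \<Longrightarrow>
    f ((y, \<sigma>), \<tau>) = g ((y, \<sigma>), \<tau>)"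
  shows "mean f = mean g"
  unfolding mean_def using assms by (intro sum.cong refl) (auto simp: system_states_def actions_def)

lemma in_pairs:
  "y \<in> PiE sites (site_states B) \<Longrightarrow> \<sigma> permutes sites \<Longrightarrow> (y, \<sigma>) \<in> system_states B"
  "\<tau> permutes sites \<Longrightarrow> \<tau> \<in> actions B"
  by (simp_all add: system_states_def actions_def)

lemma mean_nonneg:
  assumes "\<And>w. 0 \<le> f w" shows "0 \<le> mean f"
  unfolding mean_def using assms by (intro sum_nonneg mult_nonneg_nonneg nonneg)

lemma mean_sum: "(\<Sum>j\<in>J. mean (f j)) = mean (\<lambda>w. \<Sum>j\<in>J. f j w)"
  unfolding mean_def by (subst sum.swap) (simp add: sum_distrib_left)

lemma mean_cmult: "c * mean f = mean (\<lambda>w. c * f w)"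
  unfolding mean_def by (simp add: sum_distrib_left algebra_simps)

lemma mean_add: "mean f + mean g = mean (\<lambda>w. f w + g w)"
  unfolding mean_def by (simp add: sum.distrib algebra_simps)

text \<open>The weak form of the balance equation: multiply by a test function \<open>g\<close> of
  the state and sum over all states.\<close>

lemma mean_balance:
  "mean (\<lambda>w. g (fst w)) = (1 - discount B) * (\<Sum>z\<in>system_states B. init_prob B z * g z) +
    discount B * mean (\<lambda>w. \<Sum>z\<in>system_states B. next_prob B (fst w) (snd w) z * g z)"
proof -
  have "mean (\<lambda>w. g (fst w)) = (\<Sum>z\<in>system_states B. (\<Sum>a\<in>actions B. \<mu> (z, a)) * g z)"
    unfolding mean_def sum.cartesian_product' by (simp add: sum_distrib_right)
  also have "\<dots> = (\<Sum>z\<in>system_states B. (1 - discount B) * (init_prob B z * g z) +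
      discount B * mean (\<lambda>w. next_prob B (fst w) (snd w) z * g z))"
    by (intro sum.cong refl) (simp add: balance mean_def algebra_simps sum_distrib_left)
  also have "\<dots> = (1 - discount B) * (\<Sum>z\<in>system_states B. init_prob B z * g z) +
    discount B * mean (\<lambda>w. \<Sum>z\<in>system_states B. next_prob B (fst w) (snd w) z * g z)"
    by (simp add: sum.distrib mean_sum flip: sum_distrib_left)
  finally show ?thesis .
qed

text \<open>The parameter \<open>n\<close> is the site whose state is recorded: \<open>n = s\<close>
  yields the variables \<open>u\<close> and \<open>n = a\<close> the variables \<open>v\<close>.
  Hence the two families agree by definition when \<open>s = a\<close>.\<close>

definition move_ind :: "nat \<Rightarrow> nat \<Rightarrow> nat \<Rightarrow> nat \<Rightarrow> 'x \<Rightarrow> 'x state \<times> action \<Rightarrow> real" where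
  "move_ind n i s a x w =
    of_bool (snd (fst w) i = s) * (of_bool (snd w i = a) * of_bool (fst (fst w) n = x))"

definition origin_freq :: "'x lp_vars" where
  "origin_freq i s a x = mean (move_ind s i s a x)"

definition dest_freq :: "'x lp_vars" where
  "dest_freq i s a x = mean (move_ind a i s a x)"

lemma finite_site_states: "n \<in> sites \<Longrightarrow> finite (site_states B n)"
  using wf by (simp add: wf_rbpsc_def)

lemma sum_states_of_bool:
  "y \<in> PiE sites (site_states B) \<Longrightarrow> n \<in> sites \<Longrightarrow>
    (\<Sum>x\<in>site_states B n. of_bool (y n = x) * h x) = (h (y n) :: real)"
  by (intro sum_of_bool_times finite_site_states) (auto simp: PiE_iff)

lemma sum_states_of_bool':
  "y \<in> PiE sites (site_states B) \<Longrightarrow> n \<in> sites \<Longrightarrow> (\<Sum>x\<in>site_states B n. of_bool (y n = x) :: real) = 1"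
  using sum_states_of_bool[of y n "\<lambda>_. 1"] by simp

lemma sum_sites_of_bool:
  "i \<in> sites \<Longrightarrow> \<sigma> permutes sites \<Longrightarrow> (\<Sum>s\<in>sites. of_bool (\<sigma> i = s) * h s) = (h (\<sigma> i) :: real)"
  by (intro sum_of_bool_times finite_atLeastAtMost) (simp only: permutes_in_image)

lemma sum_sites_of_bool':
  "i \<in> sites \<Longrightarrow> \<sigma> permutes sites \<Longrightarrow> (\<Sum>s\<in>sites. of_bool (\<sigma> i = s) :: real) = 1"
  using sum_sites_of_bool[of i \<sigma> "\<lambda>_. 1"] by simp

text \<open>Reindexing along the permutation turns the sum over agents into a sum over sites: each
  site holds exactly one agent.\<close>

lemma sum_agents_of_bool:
  assumes "j \<in> sites" "\<sigma> permutes sites"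
  shows "(\<Sum>i\<in>sites. of_bool (\<sigma> i = j) :: real) = 1"
proof -
  have "(\<Sum>i\<in>sites. of_bool (\<sigma> i = j) :: real) = (\<Sum>i\<in>sites. of_bool (i = j))"
    using sum.permute[OF assms(2), of "\<lambda>i. of_bool (i = j) :: real"] by (simp only: o_def)
  also have "\<dots> = 1"
    unfolding of_bool_def using assms(1) by (subst sum.delta) simp_all
  finally show ?thesis .
qed

lemma sum_other_agents_of_bool:
  assumes "j \<in> sites" "i \<in> sites" "\<sigma> permutes sites"
  shows "(\<Sum>k\<in>sites - {i}. of_bool (\<sigma> k = j) :: real) = 1 - of_bool (\<sigma> i = j)"
  using sum_agents_of_bool[OF assms(1,3)] assms(2) sum.remove[of sites i "\<lambda>k. of_bool (\<sigma> k = j) :: real"]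
  by simp

text \<open>The value \<open>1 - of_bool (\<sigma> i = j)\<close> is also that of the sum over the
  other agents: agent \<open>i\<close> is away from \<open>j\<close> exactly when another agent is
  there. This is the pointwise content of the two exclusion constraints.\<close>

lemma sum_other_sites_of_bool:
  assumes "j \<in> sites" "i \<in> sites" "\<sigma> permutes sites"
  shows "(\<Sum>a\<in>sites - {j}. of_bool (\<sigma> i = a) :: real) = 1 - of_bool (\<sigma> i = j)"
  using sum_sites_of_bool[OF assms(2,3), of "\<lambda>_. 1"] assms(1)
    sum.remove[of sites j "\<lambda>a. of_bool (\<sigma> i = a) :: real"]
  by simp

lemma sum_states_move_ind:
  assumes "y \<in> PiE sites (site_states B)" "n \<in> sites"
  shows "(\<Sum>x\<in>site_states B n. move_ind n i s a x ((y, \<sigma>), \<tau>)) = of_bool (\<sigma> i = s) * of_bool (\<tau> i = a)"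
  using sum_states_of_bool'[OF assms] by (simp add: move_ind_def flip: sum_distrib_left)

lemma sum_dest_move_ind:
  assumes "\<tau> permutes sites" "i \<in> sites"
  shows "(\<Sum>a\<in>sites. move_ind n i s a x ((y, \<sigma>), \<tau>)) = of_bool (\<sigma> i = s) * of_bool (y n = x)"
  using sum_sites_of_bool[OF assms(2,1), of "\<lambda>_. 1"]
  by (simp add: move_ind_def flip: sum_distrib_left sum_distrib_right)

lemma sum_origin_move_ind:
  assumes "\<sigma> permutes sites" "i \<in> sites"
  shows "(\<Sum>s\<in>sites. move_ind n i s a x ((y, \<sigma>), \<tau>)) = of_bool (\<tau> i = a) * of_bool (y n = x)"
  using sum_sites_of_bool[OF assms(2,1), of "\<lambda>_. 1"]
  by (simp add: move_ind_def flip: sum_distrib_left sum_distrib_right)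

lemma sum_origin_freq_states:
  assumes "s \<in> sites"
  shows "(\<Sum>x\<in>site_states B s. origin_freq i s a x) =
    mean (\<lambda>w. of_bool (snd (fst w) i = s) * of_bool (snd w i = a))"
  unfolding origin_freq_def mean_sum
  using assms by (intro mean_cong) (simp only: sum_states_move_ind fst_conv snd_conv)

text \<open>Summing out the recorded state forgets which site it belonged to, so the result is the
  same as for the origin frequencies.\<close>

lemma sum_dest_freq_states:
  assumes "a \<in> sites"
  shows "(\<Sum>x\<in>site_states B a. dest_freq i s a x) =
    mean (\<lambda>w. of_bool (snd (fst w) i = s) * of_bool (snd w i = a))"
  unfolding dest_freq_def mean_sum
  using assms by (intro mean_cong) (simp only: sum_states_move_ind fst_conv snd_conv)

lemma sum_origin_freq_origins:
  assumes "i \<in> sites"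
  shows "(\<Sum>s\<in>sites. \<Sum>x\<in>site_states B s. origin_freq i s a x) =
    mean (\<lambda>w. of_bool (snd w i = a))"
proof -
  have "(\<Sum>s\<in>sites. \<Sum>x\<in>site_states B s. origin_freq i s a x)
    = mean (\<lambda>w. \<Sum>s\<in>sites. of_bool (snd (fst w) i = s) * of_bool (snd w i = a))"
    unfolding mean_sum[symmetric] by (intro sum.cong refl sum_origin_freq_states)
  also have "\<dots> = mean (\<lambda>w. of_bool (snd w i = a))"
    by (intro mean_cong) 
      (simp only: fst_conv snd_conv sum_distrib_right[symmetric] sum_sites_of_bool'[OF assms] mult_1_left)
  finally show ?thesis .
qed

lemma sum_dest_freq_dests:
  assumes "i \<in> sites"
  shows "(\<Sum>a\<in>sites. \<Sum>x\<in>site_states B a. dest_freq i s a x) =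
    mean (\<lambda>w. of_bool (snd (fst w) i = s))"
proof -
  have "(\<Sum>a\<in>sites. \<Sum>x\<in>site_states B a. dest_freq i s a x)
    = mean (\<lambda>w. \<Sum>a\<in>sites. of_bool (snd (fst w) i = s) * of_bool (snd w i = a))"
    unfolding mean_sum[symmetric] by (intro sum.cong refl sum_dest_freq_states)
  also have "\<dots> = mean (\<lambda>w. of_bool (snd (fst w) i = s))"
    by (intro mean_cong)
      (simp only: fst_conv snd_conv sum_distrib_left[symmetric] sum_sites_of_bool'[OF assms] mult_1_right)
  finally show ?thesis .
qed

text \<open>The weak balance equation is tested with the indicator that agent \<open>i\<close> is at
  \<open>s\<close> and site \<open>s\<close> is in state \<open>x\<close>; the two marginal lemmas
  evaluate its right-hand side.\<close>

lemma freq_balance: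
  assumes i: "i \<in> sites" and s: "s \<in> sites" and x: "x \<in> site_states B s"
  shows "(\<Sum>a\<in>sites. origin_freq i s a x) - discount B * (\<Sum>y\<in>site_states B s. \<Sum>s'\<in>sites.
      dest_freq i s' s y * trans_prob B (if i \<le> num_active B then 1 else 0) s y x)
    = (1 - discount B) * init_dist B s x * (if s = init_site B i then 1 else 0)"
proof -
  let ?b = "if i \<le> num_active B then 1 else 0 :: nat"
  let ?g = "\<lambda>z. of_bool (snd z i = s) * of_bool (fst z s = x) :: real"
  have "(\<Sum>a\<in>sites. origin_freq i s a x) = mean (\<lambda>w. ?g (fst w))"
    unfolding origin_freq_def mean_sum using i
    by (intro mean_cong) (simp only: sum_dest_move_ind fst_conv snd_conv)
  also have "\<dots> = (1 - discount B) * (init_dist B s x * of_bool (init_site B i = s)) +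
    discount B * mean (\<lambda>w. \<Sum>z\<in>system_states B. next_prob B (fst w) (snd w) z * ?g z)"
    by (subst mean_balance) (simp only: sum_init_prob_marginal[OF wf s x])
  also have "mean (\<lambda>w. \<Sum>z\<in>system_states B. next_prob B (fst w) (snd w) z * ?g z)
    = mean (\<lambda>w. of_bool (snd w i = s) * trans_prob B ?b s (fst (fst w) s) x)"
    by (intro mean_cong)
       (simp only: sum_next_prob_marginal[OF wf _ _ s x] fst_conv snd_conv in_pairs)
  also have "\<dots> = (\<Sum>y\<in>site_states B s. \<Sum>s'\<in>sites. dest_freq i s' s y * trans_prob B ?b s y x)"
  \<comment> \<open>The transition probability is split according to the current state
    \<open>y\<close> of site \<open>s\<close>. Agent \<open>i\<close> is sent to \<open>s\<close>,
    so the frequencies that appear are those recording the destination.\<close>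
  proof -
    have "(\<Sum>s'\<in>sites. dest_freq i s' s y) = mean (\<lambda>w. of_bool (snd w i = s) * of_bool (fst (fst w) s = y))" for y
      unfolding dest_freq_def mean_sum by (intro mean_cong) (simp only: sum_origin_move_ind[OF _ i] fst_conv snd_conv)
    then have "(\<Sum>y\<in>site_states B s. \<Sum>s'\<in>sites. dest_freq i s' s y * trans_prob B ?b s y x)
      = (\<Sum>y\<in>site_states B s. trans_prob B ?b s y x * mean (\<lambda>w. of_bool (snd w i = s) * of_bool (fst (fst w) s = y)))"
      by (simp only: sum_distrib_right[symmetric] mult.commute)
    also have "\<dots> = mean (\<lambda>w. of_bool (snd w i = s) * trans_prob B ?b s (fst (fst w) s) x)"
      unfolding mean_cmult mean_sum
    proof (intro mean_cong, unfold fst_conv snd_conv)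
      fix y \<sigma> \<tau>
      assume y: "y \<in> PiE sites (site_states B)"
      have "(\<Sum>x'\<in>site_states B s. trans_prob B ?b s x' x * (of_bool (\<tau> i = s) * of_bool (y s = x')))
        = of_bool (\<tau> i = s) * (\<Sum>x'\<in>site_states B s. of_bool (y s = x') * trans_prob B ?b s x' x)"
        unfolding sum_distrib_left by (intro sum.cong refl) simp
      then show "(\<Sum>x'\<in>site_states B s. trans_prob B ?b s x' x * (of_bool (\<tau> i = s) * of_bool (y s = x')))
        = of_bool (\<tau> i = s) * trans_prob B ?b s (y s) x"
        using sum_states_of_bool[OF y s] by simp
    qed
    finally show ?thesis ..
  qed
  finally show ?thesis by (cases "s = init_site B i") auto
qed

lemma lp_feasible_freq: "lp_feasible B origin_freq dest_freq"
  unfolding lp_feasible_def Let_def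
proof (intro conjI ballI)
  fix i s x show "origin_freq i s s x = dest_freq i s s x"
    by (simp add: origin_freq_def dest_freq_def)
next
  fix i s a x show "0 \<le> origin_freq i s a x" "0 \<le> dest_freq i s a x"
    by (auto simp: origin_freq_def dest_freq_def move_ind_def intro!: mean_nonneg)
next
  fix i s a assume "i \<in> sites" "s \<in> sites" "a \<in> sites"
  then show "(\<Sum>x\<in>site_states B s. origin_freq i s a x) = (\<Sum>x\<in>site_states B a. dest_freq i s a x)"
    by (simp add: sum_origin_freq_states sum_dest_freq_states)
next
  fix j x assume "j \<in> sites"
  show "(\<Sum>i\<in>sites. \<Sum>a\<in>sites. origin_freq i j a x) = (\<Sum>i\<in>sites. \<Sum>s\<in>sites. dest_freq i s j x)"
    unfolding origin_freq_def dest_freq_def mean_sum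
  proof (intro mean_cong)
    fix y \<sigma> \<tau>
    assume p: "\<sigma> permutes sites" "\<tau> permutes sites"
    have "(\<Sum>i\<in>sites. \<Sum>a\<in>sites. move_ind j i j a x ((y, \<sigma>), \<tau>))
      = (\<Sum>i\<in>sites. of_bool (\<sigma> i = j) * of_bool (y j = x))"
      by (intro sum.cong refl sum_dest_move_ind p)
    \<comment> \<open>Both sides record the state of the same site \<open>j\<close>, and exactly one
      agent is at \<open>j\<close> before the move and exactly one after it.\<close>
    also have "\<dots> = (\<Sum>i\<in>sites. of_bool (\<tau> i = j) * of_bool (y j = x))"
      unfolding sum_distrib_right[symmetric] sum_agents_of_bool[OF \<open>j \<in> sites\<close> p(1)]
        sum_agents_of_bool[OF \<open>j \<in> sites\<close> p(2)] ..
    also have "\<dots> = (\<Sum>i\<in>sites. \<Sum>s\<in>sites. move_ind j i s j x ((y, \<sigma>), \<tau>))"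
      by (intro sum.cong refl sum_origin_move_ind[symmetric] p)
    finally show "(\<Sum>i\<in>sites. \<Sum>a\<in>sites. move_ind j i j a x ((y, \<sigma>), \<tau>))
      = (\<Sum>i\<in>sites. \<Sum>s\<in>sites. move_ind j i s j x ((y, \<sigma>), \<tau>))" .
  qed
next
  fix i a' assume i: "i \<in> sites" and a': "a' \<in> sites"
  \<comment> \<open>Fixing the inner index set in \<open>sum.swap\<close> carries only this sum
    outward, past the other two.\<close>
  have "(\<Sum>s\<in>sites. \<Sum>x\<in>site_states B s. \<Sum>a\<in>sites - {a'}. origin_freq i s a x)
    = (\<Sum>a\<in>sites - {a'}. \<Sum>s\<in>sites. \<Sum>x\<in>site_states B s. origin_freq i s a x)"
    by (simp only: sum.swap[where B = "sites - {a'}"])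
  also have "\<dots> = mean (\<lambda>w. \<Sum>a\<in>sites - {a'}. of_bool (snd w i = a))"
    unfolding mean_sum[symmetric] by (intro sum.cong refl sum_origin_freq_origins i)
  also have "\<dots> = mean (\<lambda>w. \<Sum>k\<in>sites - {i}. of_bool (snd w k = a'))"
    by (intro mean_cong) (simp only: fst_conv snd_conv sum_other_sites_of_bool[OF a' i] sum_other_agents_of_bool[OF a' i])
  also have "\<dots> = (\<Sum>k\<in>sites - {i}. \<Sum>s\<in>sites. \<Sum>x\<in>site_states B s. origin_freq k s a' x)"
    unfolding mean_sum[symmetric] by (intro sum.cong refl sum_origin_freq_origins[symmetric]) auto
  finally show "(\<Sum>s\<in>sites. \<Sum>x\<in>site_states B s. \<Sum>a\<in>sites - {a'}. origin_freq i s a x)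
    = (\<Sum>k\<in>sites - {i}. \<Sum>s\<in>sites. \<Sum>x\<in>site_states B s. origin_freq k s a' x)" .
next
  fix i s' assume i: "i \<in> sites" and s': "s' \<in> sites"
  have "(\<Sum>a\<in>sites. \<Sum>x\<in>site_states B a. \<Sum>s\<in>sites - {s'}. dest_freq i s a x)
    = (\<Sum>s\<in>sites - {s'}. \<Sum>a\<in>sites. \<Sum>x\<in>site_states B a. dest_freq i s a x)"
    by (simp only: sum.swap[where B = "sites - {s'}"])
  also have "\<dots> = mean (\<lambda>w. \<Sum>s\<in>sites - {s'}. of_bool (snd (fst w) i = s))"
    unfolding mean_sum[symmetric] by (intro sum.cong refl sum_dest_freq_dests i)
  also have "\<dots> = mean (\<lambda>w. \<Sum>k\<in>sites - {i}. of_bool (snd (fst w) k = s'))"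
    by (intro mean_cong) (simp only: fst_conv snd_conv sum_other_sites_of_bool[OF s' i] sum_other_agents_of_bool[OF s' i])
  also have "\<dots> = (\<Sum>k\<in>sites - {i}. \<Sum>a\<in>sites. \<Sum>x\<in>site_states B a. dest_freq k s' a x)"
    unfolding mean_sum[symmetric] by (intro sum.cong refl sum_dest_freq_dests[symmetric]) auto
  finally show "(\<Sum>a\<in>sites. \<Sum>x\<in>site_states B a. \<Sum>s\<in>sites - {s'}. dest_freq i s a x)
    = (\<Sum>k\<in>sites - {i}. \<Sum>a\<in>sites. \<Sum>x\<in>site_states B a. dest_freq k s' a x)" .
qed (rule freq_balance)

text \<open>The indicators pick \<open>s = \<sigma> i\<close>, \<open>a = \<tau> i\<close> and
  \<open>x = y (\<tau> i)\<close>. The set \<open>I\<close> and the weight \<open>h\<close> are left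
  open so that the active and the passive half of the objective are both instances.\<close>

lemma sum_dest_freq:
  assumes I: "I \<subseteq> sites"
  shows "(\<Sum>s\<in>sites. \<Sum>a\<in>sites. \<Sum>x\<in>site_states B a. h s a x * (\<Sum>i\<in>I. dest_freq i s a x))
    = mean (\<lambda>w. \<Sum>i\<in>I. h (snd (fst w) i) (snd w i) (fst (fst w) (snd w i)))"
  unfolding dest_freq_def mean_sum mean_cmult
proof (intro mean_cong, unfold fst_conv snd_conv)
  fix y \<sigma> \<tau>
  assume y: "y \<in> PiE sites (site_states B)" and p: "\<sigma> permutes sites" "\<tau> permutes sites"
  have "(\<Sum>s\<in>sites. \<Sum>a\<in>sites. \<Sum>x\<in>site_states B a. h s a x * (\<Sum>i\<in>I. move_ind a i s a x ((y, \<sigma>), \<tau>)))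
    = (\<Sum>s\<in>sites. \<Sum>a\<in>sites. \<Sum>x\<in>site_states B a. \<Sum>i\<in>I.
        of_bool (\<sigma> i = s) * (of_bool (\<tau> i = a) * (of_bool (y a = x) * h s a x)))"
    unfolding sum_distrib_left by (intro sum.cong refl) (simp add: move_ind_def)
  also have "\<dots> = (\<Sum>i\<in>I. \<Sum>s\<in>sites. \<Sum>a\<in>sites. \<Sum>x\<in>site_states B a.
        of_bool (\<sigma> i = s) * (of_bool (\<tau> i = a) * (of_bool (y a = x) * h s a x)))"
    by (simp only: sum.swap[where B = I])
  also have "\<dots> = (\<Sum>i\<in>I. \<Sum>s\<in>sites. of_bool (\<sigma> i = s) * (\<Sum>a\<in>sites. of_bool (\<tau> i = a) *
      (\<Sum>x\<in>site_states B a. of_bool (y a = x) * h s a x)))"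
    unfolding sum_distrib_left ..
  also have "\<dots> = (\<Sum>i\<in>I. h (\<sigma> i) (\<tau> i) (y (\<tau> i)))"
  proof (intro sum.cong refl)
    fix i assume "i \<in> I"
    then have i: "i \<in> sites" using I by auto
    show "(\<Sum>s\<in>sites. of_bool (\<sigma> i = s) * (\<Sum>a\<in>sites. of_bool (\<tau> i = a) *
        (\<Sum>x\<in>site_states B a. of_bool (y a = x) * h s a x))) = h (\<sigma> i) (\<tau> i) (y (\<tau> i))"
      by (simp only: sum_sites_of_bool[OF i p(1)] sum_sites_of_bool[OF i p(2)] i
        sum_states_of_bool[OF y] permutes_in_image[OF p(2)])
  qed
  finally show "(\<Sum>s\<in>sites. \<Sum>a\<in>sites. \<Sum>x\<in>site_states B a. h s a x * (\<Sum>i\<in>I. move_ind a i s a x ((y, \<sigma>), \<tau>)))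
    = (\<Sum>i\<in>I. h (\<sigma> i) (\<tau> i) (y (\<tau> i)))" .
qed

lemma lp_objective_freq: "lp_objective B dest_freq = mean (\<lambda>w. total_reward B (fst w) (snd w))"
proof -
  have sub: "{1..num_active B} \<subseteq> sites" "{num_active B + 1..num_sites B} \<subseteq> sites"
    using wf by (auto simp: wf_rbpsc_def)
  show ?thesis
    unfolding lp_objective_def sum.distrib
    unfolding sum_dest_freq[OF sub(1), of "\<lambda>s a x. reward B 1 a x - switch_cost B s a"]
      sum_dest_freq[OF sub(2), of "\<lambda>s a x. reward B 0 a x"] mean_add
    by (intro mean_cong) (simp add: total_reward_def)
qed

lemma mean_reward_le_lp_value: "ereal (mean (\<lambda>w. total_reward B (fst w) (snd w))) \<le> lp_value B"
  unfolding lp_value_def lp_objective_freq[symmetric]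
  by (rule SUP_upper2[of "(origin_freq, dest_freq)"]) (auto simp: lp_feasible_freq)

end

section \<open>Passage to the supremum over policies\<close>

theorem theorem3p1:
  fixes B :: "'x rbpsc"
  assumes "wf_rbpsc B"
  shows "ereal (1 - discount B) * optimal_reward B \<le> lp_value B"
proof -
  \<comment> \<open>The policy that always plays the identity shows that the supremum is over a
    nonempty set, as required for moving the factor inside it in \<open>ereal\<close>.\<close>
  have "(\<lambda>_ _. return_pmf id) \<in> policies B"
    by (simp add: policies_def actions_def permutes_id)
  then have "policies B \<noteq> {}"
    by blast
  moreover have "0 \<le> 1 - discount B"
    using assms by (simp add: wf_rbpsc_def)
  ultimately have "ereal (1 - discount B) * optimal_reward B
    = (SUP \<pi>\<in>policies B. ereal (1 - discount B) * ereal (expected_reward B \<pi>))"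
    unfolding optimal_reward_def by (rule Sup_ereal_mult_left')
  also have "\<dots> \<le> lp_value B"
  proof (rule SUP_least)
    fix \<pi> assume \<pi>: "\<pi> \<in> policies B"
    interpret rbpsc_policy B \<pi>
      by unfold_locales (use assms \<pi> in auto)
    interpret occupation B disc_occ
      by unfold_locales (simp_all add: assms disc_occ_nonneg disc_occ_balance)
    have "(1 - discount B) * expected_reward B \<pi> = mean (\<lambda>w. total_reward B (fst w) (snd w))"
      by (simp add: expected_reward_disc_occ mean_def split_beta)
    then show "ereal (1 - discount B) * ereal (expected_reward B \<pi>) \<le> lp_value B"
      using mean_reward_le_lp_value by simp
  qed
  finally show ?thesis .
qed

end
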